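(* The event $$\{\omega\in\Omega\mid\text{for each }t\in[0,1]\text{ either }D^+W_t(\omega)=\infty\text{ or }D_+W_t(\omega)=-\infty\}$$ contains an event $E\in\mathcal A$ with $\mathbb P(E)=1$. Moreover, for $c_\pi:=\frac{2^{10}}{\pi^2}$ and any $R\in(1,2^{1/4})$, for $$\mathfrak m_R:=\sup\Big\{n\in\mathbb N_0\ \Big|\ \exists\,s\in[0,1]:\ \sup_{t\in[s-2^{-n},s+2^{-n}]\cap[0,1]}\frac{|W_s-W_t|}{2^{-n}}\le R^n\Big\}$$ and $$\mathcal O_R:=\#\Big\{n\in\mathbb N_0\ \Big|\ \exists\,s\in[0,1]:\ \sup_{t\in[s-2^{-n},s+2^{-n}]\cap[0,1]}\frac{|W_s-W_t|}{2^{-n}}\le R^n\Big\}$$ we have that for all $\omega\in E$ and $n>\mathfrak m_R(\omega)$ $$\forall\,s\in[0,1]:\ \sup_{t\in[s-2^{-n},s+2^{-n}]\cap[0,1]}\frac{|W_s-W_t|}{2^{-n}}>R^n,$$ and for all $k\in\mathbb N$, $k\ge1$, $$\mathbb P(\mathcal O_R\ge k)\le\mathbb P(\mathfrak m_R\ge k)\le2e^{\frac98}\cdot\Big[k\Big(\frac{2c_\pi}{R^4}+1\Big)+1\Big]\cdot\Big(\frac{R^4}2\Big)^k.$$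
   Context: $W$ is a standard scalar Brownian motion on a probability space $(\Omega,\mathcal A,\mathbb P)$; $\mathbb N_0=\{0,1,2,\dots\}$. $D^+f$ and $D_+f$ denote the right upper and right lower Dini derivatives of a function $f$: $D^+f(t)=\limsup_{h\downarrow0}\frac{f(t+h)-f(t)}h$, $D_+f(t)=\liminf_{h\downarrow0}\frac{f(t+h)-f(t)}h$.
   Formalization: The inequality P(O_R≥k) ≤ P(m_R≥k) fails at k=1, since level n=0 is counted in O_R and only level 0 is slow with positive probability; it is replaced by P(O_R≥k+1) ≤ P(m_R≥k), and the final bound is proved for both P(O_R≥k) and P(m_R≥k). *)

theory Defs
  imports "HOL-Probability.Probability" "HOL-Library.Extended_Nat"
begin

text \<open>All sample paths are continuous on the half-line, the value at time 0 is 0 almost surely.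
  The values \<open>W t\<close> for \<open>t < 0\<close> are unconstrained.\<close>

locale brownian_motion = prob_space M
  for M :: "'w measure" and W :: "real \<Rightarrow> 'w \<Rightarrow> real" +
  assumes random_variable: "\<And>t. 0 \<le> t \<Longrightarrow> random_variable borel (W t)"
    and start_zero: "AE \<omega> in M. W 0 \<omega> = 0"
    and independent_increments:
      "\<And>(n::nat) (t::nat \<Rightarrow> real). 0 \<le> t 0 \<Longrightarrow> (\<And>i. i < n \<Longrightarrow> t i < t (Suc i)) \<Longrightarrow>
         indep_vars (\<lambda>_. borel) (\<lambda>i \<omega>. W (t (Suc i)) \<omega> - W (t i) \<omega>) {..<n}"
    and gaussian_increments:
      "\<And>s t. 0 \<le> s \<Longrightarrow> s < t \<Longrightarrow>
         distributed M lborel (\<lambda>\<omega>. W t \<omega> - W s \<omega>) (normal_density 0 (sqrt (t - s)))"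
    and continuous_paths: "\<And>\<omega>. \<omega> \<in> space M \<Longrightarrow> continuous_on {0..} (\<lambda>t. W t \<omega>)"

definition upper_right_dini :: "(real \<Rightarrow> real) \<Rightarrow> real \<Rightarrow> ereal" where
  "upper_right_dini f t = Limsup (at_right 0) (\<lambda>h. ereal ((f (t + h) - f t) / h))"

definition lower_right_dini :: "(real \<Rightarrow> real) \<Rightarrow> real \<Rightarrow> ereal" where
  "lower_right_dini f t = Liminf (at_right 0) (\<lambda>h. ereal ((f (t + h) - f t) / h))"

text \<open>For \<open>s \<in> {0..1}\<close> and \<open>f\<close> continuous on \<open>{0..1}\<close> the supremum is over a nonempty set that is
  bounded above, so the real-valued supremum is the true one.\<close>

definition window_osc :: "(real \<Rightarrow> real) \<Rightarrow> nat \<Rightarrow> real \<Rightarrow> real" where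
  "window_osc f n s =
     (SUP t \<in> {s - (1/2) ^ n .. s + (1/2) ^ n} \<inter> {0..1}. \<bar>f s - f t\<bar> / (1/2) ^ n)"

definition slow_levels :: "real \<Rightarrow> (real \<Rightarrow> real) \<Rightarrow> nat set" where
  "slow_levels R f = {n. \<exists>s\<in>{0..1}. window_osc f n s \<le> R ^ n}"

text \<open>Suprema of sets of natural numbers are taken in \<open>enat\<close>: the supremum of an infinite set is
  \<open>\<infinity>\<close>, that of the empty set is 0.\<close>

definition last_slow_level :: "real \<Rightarrow> (real \<Rightarrow> real) \<Rightarrow> enat" where
  "last_slow_level R f = (SUP n \<in> slow_levels R f. enat n)"

definition number_slow_levels :: "real \<Rightarrow> (real \<Rightarrow> real) \<Rightarrow> enat" where
  "number_slow_levels R f =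
     (if finite (slow_levels R f) then enat (card (slow_levels R f)) else \<infinity>)"

definition c_pi :: real where
  "c_pi = 2 ^ 10 / pi\<^sup>2"

definition tail_bound :: "real \<Rightarrow> nat \<Rightarrow> real" where
  "tail_bound R k = 2 * exp (9/8) * (real k * (2 * c_pi / R ^ 4 + 1) + 1) * (R ^ 4 / 2) ^ k"

end

theory Submission
  imports Defs
begin

text \<open>Both parts rest on one small-ball estimate: four consecutive increments of the Brownian motion
  over steps of length \<open>\<eta>\<close> are independent Gaussians with density at most \<open>1 / sqrt (2 * pi * \<eta>)\<close>, so they
  are all at most \<open>b\<close> in absolute value with probability at most \<open>(2 * b / sqrt (2 * pi * \<eta>)) ^ 4\<close>.

  A slow point at level \<open>n\<close> forces this with \<open>\<eta> = (1/2) ^ n / 4\<close> and \<open>b = 2 * (1/2) ^ n * R ^ n\<close> in one of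
  \<open>2 ^ n\<close> dyadic intervals, so level \<open>n\<close> is slow with probability at most \<open>c_pi * q ^ n\<close>, where
  \<open>q = R ^ 4 / 2 < 1\<close>. If \<open>k\<close> levels are slow, then some level \<open>n \<ge> k - 1\<close> is, which has probability at
  most \<open>c_pi * q ^ (k - 1) / (1 - q)\<close>. This is at most the tail bound if \<open>1 / (1 - q) \<le> 2 * k\<close>;
  otherwise \<open>q ^ k \<ge> 1/2\<close> by Bernoulli's inequality and the tail bound is at least 1.

  A point where both Dini derivatives are finite forces, for some \<open>K\<close> and all large \<open>n\<close>, four increments over
  steps of length \<open>1 / n\<close> of size at most \<open>10 * K / n\<close>, starting at one of \<open>n + 1\<close> grid points; this
  has probability of order \<open>1 / n\<close>.\<close>

section \<open>Reduction of the slow level condition to countably many conditions\<close>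

text \<open>The slack \<open>1 / real (Suc m)\<close> pays for moving a real \<open>x\<close> to a
  nearby rational, uniformly in \<open>y\<close>. Conversely, \<open>retract\<close> puts the
  rational witnesses into the compact unit interval. A subsequential limit of them satisfies the
  bound \<open>c\<close> itself at all rational \<open>y\<close>, hence at all \<open>y\<close> by
  continuity.\<close>

lemma exists_forall_le_iff_rational:
  fixes F :: "real \<Rightarrow> real \<Rightarrow> real"
  assumes equicont: "\<And>e. e > 0 \<Longrightarrow> \<exists>d>0. \<forall>x x' y. \<bar>x - x'\<bar> < d \<longrightarrow> \<bar>F x y - F x' y\<bar> < e"
    and cont: "\<And>x. continuous_on UNIV (F x)"
    and retract: "\<And>x. \<exists>x'\<in>{0..1}. F x = F x'"
  shows "(\<exists>x. \<forall>y. F x y \<le> c) \<longleftrightarrow> (\<forall>m::nat. \<exists>x\<in>\<rat>. \<forall>y\<in>\<rat>. F x y \<le> c + 1 / real (Suc m))"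
proof
  assume "\<exists>x. \<forall>y. F x y \<le> c"
  then obtain x where x: "\<And>y. F x y \<le> c" by blast
  show "\<forall>m::nat. \<exists>x\<in>\<rat>. \<forall>y\<in>\<rat>. F x y \<le> c + 1 / real (Suc m)"
  proof
    fix m :: nat
    obtain d where d: "d > 0" "\<And>x x' y. \<bar>x - x'\<bar> < d \<Longrightarrow> \<bar>F x y - F x' y\<bar> < 1 / real (Suc m)"
      using equicont[of "1 / real (Suc m)"] by auto
    obtain x' where x': "x' \<in> \<rat>" "x < x'" "x' < x + d"
      using Rats_dense_in_real[of x "x + d"] d(1) by auto
    have "F x' y \<le> c + 1 / real (Suc m)" for y
      using d(2)[of x x' y] x' x[of y] by linarith
    with x'(1) show "\<exists>x\<in>\<rat>. \<forall>y\<in>\<rat>. F x y \<le> c + 1 / real (Suc m)" by blast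
  qed
next
  assume "\<forall>m::nat. \<exists>x\<in>\<rat>. \<forall>y\<in>\<rat>. F x y \<le> c + 1 / real (Suc m)"
  then have "\<forall>m::nat. \<exists>x\<in>{0..1}. \<forall>y\<in>\<rat>. F x y \<le> c + 1 / real (Suc m)"
    using retract by metis
  then obtain X :: "nat \<Rightarrow> real" where X: "\<And>m. X m \<in> {0..1}"
    "\<And>m y. y \<in> \<rat> \<Longrightarrow> F (X m) y \<le> c + 1 / real (Suc m)"
    by metis
  obtain l r where l: "strict_mono (r :: nat \<Rightarrow> nat)" "(X \<circ> r) \<longlonglongrightarrow> l"
    using compact_Icc[of "0::real" 1] X(1) unfolding compact_def by metis
  have rat: "F l y \<le> c" if "y \<in> \<rat>" for y
  proof (rule LIMSEQ_le)
    show "(\<lambda>m. F (X (r m)) y) \<longlonglongrightarrow> F l y"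
    proof (rule LIMSEQ_I)
      fix e :: real assume "0 < e"
      then obtain d where d: "d > 0" "\<And>x x' y. \<bar>x - x'\<bar> < d \<Longrightarrow> \<bar>F x y - F x' y\<bar> < e"
        using equicont[of e] by auto
      obtain N where "\<forall>n\<ge>N. \<bar>X (r n) - l\<bar> < d"
        using LIMSEQ_D[OF l(2) d(1)] by auto
      then have "\<forall>n\<ge>N. norm (F (X (r n)) y - F l y) < e" using d(2) by simp
      then show "\<exists>N. \<forall>n\<ge>N. norm (F (X (r n)) y - F l y) < e" by blast
    qed
    have "(\<lambda>m. c + 1 / real (Suc m)) \<longlonglongrightarrow> c + 0"
      by (intro tendsto_intros LIMSEQ_Suc[OF lim_1_over_n])
    then show "(\<lambda>m. c + 1 / real (Suc (r m))) \<longlonglongrightarrow> c"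
      using LIMSEQ_subseq_LIMSEQ[OF _ l(1)] by (fastforce simp: o_def)
    show "\<exists>N. \<forall>n\<ge>N. F (X (r n)) y \<le> c + 1 / real (Suc (r n))"
      using X(2)[OF that] by blast
  qed
  have "closed {y. F l y \<le> c}"
    by (intro closed_Collect_le cont continuous_on_const)
  moreover have "\<rat> \<subseteq> {y. F l y \<le> c}" using rat by blast
  ultimately have "closure \<rat> \<subseteq> {y. F l y \<le> c}" by (rule closure_minimal[rotated])
  then show "\<exists>x. \<forall>y. F x y \<le> c" by (auto simp: Rats_closure_real)
qed

lemma window_osc_le_iff:
  fixes f :: "real \<Rightarrow> real"
  assumes "continuous_on {0..1} f" "s \<in> {0..1}"
  shows "window_osc f n s \<le> c \<longleftrightarrow>
    (\<forall>t\<in>{s - (1/2) ^ n .. s + (1/2) ^ n} \<inter> {0..1}. \<bar>f s - f t\<bar> \<le> c * (1/2) ^ n)"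
proof -
  let ?S = "{s - (1/2) ^ n .. s + (1/2) ^ n} \<inter> {0..1::real}"
  have "s \<in> ?S" using assms(2) by simp
  then have ne: "?S \<noteq> {}" by blast
  have "compact ((\<lambda>t. \<bar>f s - f t\<bar> / (1/2) ^ n) ` {0..1})"
    by (intro compact_continuous_image continuous_intros assms(1)) auto
  then have "bdd_above ((\<lambda>t. \<bar>f s - f t\<bar> / (1/2) ^ n) ` {0..1})"
    by (intro bounded_imp_bdd_above compact_imp_bounded)
  then have bdd: "bdd_above ((\<lambda>t. \<bar>f s - f t\<bar> / (1/2) ^ n) ` ?S)"
    by (rule bdd_above_mono) auto
  show ?thesis
    unfolding window_osc_def cSUP_le_iff[OF ne bdd] by (simp add: field_simps)
qed

text \<open>This exhibits slowness as countably many conditions on single values of the path.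
  Clamping with \<open>cl\<close> and measuring the offset in units of the window radius
  parametrises all pairs of \<open>s\<close> and a point of its window by the whole plane, so the
  range of \<open>y\<close> does not depend on \<open>s\<close>.\<close>

lemma slow_level_iff_rational:
  fixes f :: "real \<Rightarrow> real"
  assumes cont: "continuous_on {0..1} f"
  defines "cl \<equiv> \<lambda>x::real. max 0 (min 1 x)"
  shows "n \<in> slow_levels R f \<longleftrightarrow> (\<forall>m::nat. \<exists>x\<in>\<rat>. \<forall>y\<in>\<rat>.
    \<bar>f (cl x) - f (cl (cl x + (1/2) ^ n * max (-1) (min 1 y)))\<bar>
      \<le> R ^ n * (1/2) ^ n + 1 / real (Suc m))"
proof -
  define F where "F x y = \<bar>f (cl x) - f (cl (cl x + (1/2) ^ n * max (-1) (min 1 y)))\<bar>" for x y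
  have cl: "cl x \<in> {0..1}" for x by (auto simp: cl_def)
  have clid: "cl x = x" if "x \<in> {0..1}" for x using that by (auto simp: cl_def)
  have "n \<in> slow_levels R f \<longleftrightarrow> (\<exists>x. \<forall>y. F x y \<le> R ^ n * (1/2) ^ n)"
  proof
    assume "n \<in> slow_levels R f"
    then obtain s where s: "s \<in> {0..1}" "window_osc f n s \<le> R ^ n"
      by (auto simp: slow_levels_def)
    have "F s y \<le> R ^ n * (1/2) ^ n" for y
    proof -
      define u where "u = (1/2) ^ n * max (-1) (min 1 y)"
      have "\<bar>u\<bar> \<le> (1/2) ^ n * 1"
        unfolding u_def abs_mult by (intro mult_mono) auto
      then have "cl (s + u) \<in> {s - (1/2) ^ n .. s + (1/2) ^ n} \<inter> {0..1}"
        using s(1) by (auto simp: cl_def)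
      then have "\<bar>f s - f (cl (s + u))\<bar> \<le> R ^ n * (1/2) ^ n"
        using s(2) window_osc_le_iff[OF cont s(1)] by blast
      then show ?thesis by (simp add: F_def clid[OF s(1)] u_def)
    qed
    then show "\<exists>x. \<forall>y. F x y \<le> R ^ n * (1/2) ^ n" by blast
  next
    assume "\<exists>x. \<forall>y. F x y \<le> R ^ n * (1/2) ^ n"
    then obtain x where x: "\<And>y. F x y \<le> R ^ n * (1/2) ^ n" by blast
    have "\<bar>f (cl x) - f t\<bar> \<le> R ^ n * (1/2) ^ n"
      if t: "t \<in> {cl x - (1/2) ^ n .. cl x + (1/2) ^ n} \<inter> {0..1}" for t
    proof -
      define y where "y = (t - cl x) * 2 ^ n"
      have eq: "(1/2) ^ n * y = t - cl x" by (simp add: y_def power_divide)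
      have "(1/2) ^ n * y \<le> (1/2) ^ n * 1" "(1/2) ^ n * (-1) \<le> (1/2) ^ n * y"
        unfolding eq using t by auto
      then have "y \<le> 1" "-1 \<le> y"
        by (simp_all only: mult_le_cancel_left_pos[of "(1/2::real) ^ n"] zero_less_power half_gt_zero zero_less_one)
      then have "F x y = \<bar>f (cl x) - f t\<bar>"
        using eq t by (simp add: F_def clid)
      with x[of y] show ?thesis by simp
    qed
    then have "window_osc f n (cl x) \<le> R ^ n"
      using window_osc_le_iff[OF cont cl] by blast
    then show "n \<in> slow_levels R f" using cl by (auto simp: slow_levels_def)
  qed
  also have "\<dots> \<longleftrightarrow> (\<forall>m::nat. \<exists>x\<in>\<rat>. \<forall>y\<in>\<rat>. F x y \<le> R ^ n * (1/2) ^ n + 1 / real (Suc m))"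
  proof (rule exists_forall_le_iff_rational)
    fix e :: real assume "e > 0"
    have "uniformly_continuous_on {0..1} f"
      using cont by (intro compact_uniformly_continuous) auto
    then obtain d where d: "d > 0"
      "\<And>u v. u \<in> {0..1} \<Longrightarrow> v \<in> {0..1} \<Longrightarrow> \<bar>u - v\<bar> < d \<Longrightarrow> \<bar>f u - f v\<bar> < e / 2"
      unfolding uniformly_continuous_on_def dist_real_def
      using \<open>e > 0\<close> by (metis half_gt_zero)
    have "\<bar>F x y - F x' y\<bar> < e" if "\<bar>x - x'\<bar> < d" for x x' y
    proof -
      define u where "u = (1/2) ^ n * max (-1) (min 1 y)"
      \<comment> \<open>As the clamp is 1-Lipschitz, replacing \<open>x\<close> by \<open>x'\<close>
        moves both path arguments by at most \<open>\<bar>x - x'\<bar>\<close>, whatever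
        \<open>y\<close> is; each contributes \<open>e / 2\<close>.\<close>
      have lip: "\<bar>cl a - cl b\<bar> \<le> \<bar>a - b\<bar>" for a b
        by (auto simp: cl_def max_def min_def)
      have "\<bar>cl x - cl x'\<bar> < d" "\<bar>cl (cl x + u) - cl (cl x' + u)\<bar> < d"
        using that lip[of x x'] lip[of "cl x + u" "cl x' + u"] by linarith+
      then have "\<bar>f (cl x) - f (cl x')\<bar> < e / 2" "\<bar>f (cl (cl x + u)) - f (cl (cl x' + u))\<bar> < e / 2"
        using d(2) cl by auto
      then show ?thesis unfolding F_def u_def[symmetric] by linarith
    qed
    with d(1) show "\<exists>d>0. \<forall>x x' y. \<bar>x - x'\<bar> < d \<longrightarrow> \<bar>F x y - F x' y\<bar> < e" by blast
  next
    fix x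
    have "continuous_on UNIV (\<lambda>y. f (cl (cl x + (1/2) ^ n * max (-1) (min 1 y))))"
      using cl by (intro continuous_on_compose2[OF cont])
        (auto simp: cl_def intro!: continuous_intros)
    then show "continuous_on UNIV (F x)"
      unfolding F_def[abs_def] by (intro continuous_on_rabs continuous_on_diff continuous_on_const)
  next
    fix x
    have "F x = F (cl x)" by (simp add: F_def clid[OF cl] fun_eq_iff)
    then show "\<exists>x'\<in>{0..1}. F x = F x'" using cl by blast
  qed
  finally show ?thesis unfolding F_def .
qed

section \<open>Supremum and number of the slow levels\<close>

text \<open>The case \<open>k = 0\<close> is excluded because the supremum of the empty set is 0, so
  that \<open>enat 0\<close> is a lower bound even if no level is slow.\<close>

lemma enat_le_last_slow_level_iff:
  assumes "1 \<le> k"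
  shows "enat k \<le> last_slow_level R f \<longleftrightarrow> (\<exists>n\<ge>k. n \<in> slow_levels R f)"
proof
  assume *: "enat k \<le> last_slow_level R f"
  show "\<exists>n\<ge>k. n \<in> slow_levels R f"
  proof (rule ccontr)
    assume "\<not> (\<exists>n\<ge>k. n \<in> slow_levels R f)"
    then have "i \<le> k - 1" if "i \<in> slow_levels R f" for i
      using that by (cases "k \<le> i") auto
    then have "last_slow_level R f \<le> enat (k - 1)"
      unfolding last_slow_level_def by (intro SUP_least) simp
    with * have "enat k \<le> enat (k - 1)" by (rule order_trans)
    with assms show False by simp
  qed
next
  assume "\<exists>n\<ge>k. n \<in> slow_levels R f"
  then show "enat k \<le> last_slow_level R f"
    unfolding last_slow_level_def by (auto intro: SUP_upper2)
qed

lemma enat_le_number_slow_levels_iff: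
  "enat k \<le> number_slow_levels R f \<longleftrightarrow> (\<exists>F. finite F \<and> card F = k \<and> F \<subseteq> slow_levels R f)"
proof (cases "finite (slow_levels R f)")
  case True
  then show ?thesis
    using obtain_subset_with_card_n[of k "slow_levels R f"] card_mono[OF True]
    by (auto simp: number_slow_levels_def)
next
  case False
  then show ?thesis
    using infinite_arbitrarily_large[OF False, of k] by (auto simp: number_slow_levels_def)
qed

text \<open>Pigeonhole: only \<open>k\<close> levels lie below \<open>k\<close>, since level 0
  counts.\<close>

lemma ex_slow_level_of_number:
  assumes "enat (Suc k) \<le> number_slow_levels R f"
  shows "\<exists>n\<ge>k. n \<in> slow_levels R f"
proof -
  obtain F where F: "finite F" "card F = Suc k" "F \<subseteq> slow_levels R f"
    using assms enat_le_number_slow_levels_iff by blast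
  have "\<not> F \<subseteq> {..<k}"
    using F(2) card_mono[of "{..<k}" F] by auto
  with F(3) show ?thesis by (auto simp: not_less)
qed

text \<open>The exponent is \<open>k - 1\<close> because \<open>k\<close> slow levels guarantee one
  only at level \<open>k - 1\<close> or above; the same estimate then serves the supremum
  too.\<close>

lemma geometric_tail_le_tail_bound:
  assumes R: "0 < R" "R ^ 4 < 2" and k: "1 \<le> k" and p: "p \<le> 1"
    and p_le: "p \<le> c_pi * (R ^ 4 / 2) ^ (k - 1) / (1 - R ^ 4 / 2)"
  shows "p \<le> tail_bound R k"
proof -
  define q where "q = R ^ 4 / 2"
  have q: "0 < q" "q < 1" using R by (auto simp: q_def)
  have c: "c_pi > 0" by (simp add: c_pi_def)
  \<comment> \<open>The tail bound without its factor \<open>2 * exp (9/8)\<close>; note that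
    \<open>2 * c_pi / R ^ 4 = c_pi / q\<close>. Of the exponential only
    \<open>exp (9/8) \<ge> 1\<close> enters.\<close>
  define B where "B = (real k * (c_pi / q + 1) + 1) * q ^ k"
  have B0: "0 \<le> B" using q c by (simp add: B_def)
  have "2 * B \<le> 2 * exp (9/8) * B"
    using B0 by (intro mult_right_mono) auto
  also have "\<dots> = tail_bound R k"
    by (simp add: B_def tail_bound_def q_def mult.assoc)
  finally have tb: "2 * B \<le> tail_bound R k" .
  show ?thesis
  proof (cases "1 \<le> 2 * real k * (1 - q)")
    case True
    have "p \<le> (c_pi * q ^ (k - 1)) * (1 / (1 - q))"
      using p_le by (simp add: q_def)
    also have "\<dots> \<le> (c_pi * q ^ (k - 1)) * (2 * real k)"
      using True q c by (intro mult_left_mono) (auto simp: field_simps)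
    \<comment> \<open>Raising the exponent from \<open>k - 1\<close> to \<open>k\<close> costs the
      factor \<open>1 / q\<close>, which matches the term \<open>c_pi / q\<close> in
      \<open>B\<close>.\<close>
    also have "\<dots> = 2 * (real k * (c_pi / q) * q ^ k)"
      using q k by (cases k) (auto simp: field_simps)
    also have "\<dots> \<le> 2 * B"
      unfolding B_def using q c by (intro mult_left_mono mult_right_mono) (auto simp: algebra_simps)
    finally show ?thesis using tb by linarith
  next
    case False
    have "1 + real k * (q - 1) \<le> (1 + (q - 1)) ^ k"
      using q by (intro Bernoulli_inequality) auto
    then have half: "1 / 2 \<le> q ^ k" using False by (simp add: algebra_simps)
    have "1 * q ^ k \<le> B"
      unfolding B_def using q c by (intro mult_right_mono) auto
    with half p tb show ?thesis by linarith
  qed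
qed

section \<open>Small-ball estimate for four Gaussian increments\<close>

context brownian_motion
begin

lemma prob_increment_le:
  assumes "0 \<le> s" "s < t" "0 \<le> b"
  shows "prob ((\<lambda>\<omega>. W t \<omega> - W s \<omega>) -` {-b..b} \<inter> space M) \<le> 2 * b / sqrt (2 * pi * (t - s))"
proof -
  have "emeasure M ((\<lambda>\<omega>. W t \<omega> - W s \<omega>) -` {-b..b} \<inter> space M) =
    (\<integral>\<^sup>+x. ennreal (normal_density 0 (sqrt (t - s)) x) * indicator {-b..b} x \<partial>lborel)"
    using distributed_emeasure[OF gaussian_increments[OF assms(1,2)], of "{-b..b}"] by simp
  also have "\<dots> \<le> (\<integral>\<^sup>+x. ennreal (1 / sqrt (2 * pi * (t - s))) * indicator {-b..b} x \<partial>lborel)"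
  proof (intro nn_integral_mono mult_right_mono ennreal_leI)
    fix x
    have "exp (- (x\<^sup>2 / (2 * (t - s)))) \<le> 1" using assms by simp
    then show "normal_density 0 (sqrt (t - s)) x \<le> 1 / sqrt (2 * pi * (t - s))"
      using assms by (simp add: normal_density_def divide_right_mono)
  qed simp
  also have "\<dots> = ennreal (1 / sqrt (2 * pi * (t - s))) * ennreal (2 * b)"
    using assms by (simp add: nn_integral_cmult)
  also have "\<dots> = ennreal (2 * b / sqrt (2 * pi * (t - s)))"
    using assms by (simp add: ennreal_mult[symmetric])
  finally show ?thesis
    using assms by (simp add: emeasure_eq_measure)
qed

text \<open>Why four: for \<open>m\<close> increments with step of order \<open>(1/2) ^ n\<close>
  and bound of order \<open>(1/2) ^ n * R ^ n\<close>, a union over \<open>2 ^ n\<close> intervals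
  has probability of order at most \<open>(2 powr (1 - m/2) * R ^ m) ^ n\<close>. For
  \<open>m = 4\<close> the base is \<open>R ^ 4 / 2\<close>.\<close>

definition small_increments :: "real \<Rightarrow> real \<Rightarrow> real \<Rightarrow> 'w set" where
  "small_increments b \<eta> a =
    {\<omega> \<in> space M. \<forall>i<4::nat. \<bar>W (a + real (Suc i) * \<eta>) \<omega> - W (a + real i * \<eta>) \<omega>\<bar> \<le> b}"

lemma sets_small_increments:
  assumes "0 \<le> a" "0 < \<eta>"
  shows "small_increments b \<eta> a \<in> events"
proof -
  have [measurable]: "W (a + real i * \<eta>) \<in> borel_measurable M" for i
    using assms by (intro random_variable) auto
  show ?thesis unfolding small_increments_def by measurable
qed

lemma prob_small_increments_le:
  assumes "0 \<le> a" "0 < \<eta>" "0 \<le> b"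
  shows "prob (small_increments b \<eta> a) \<le> 4 * b ^ 4 / (pi\<^sup>2 * \<eta>\<^sup>2)"
proof -
  define t where "t i = a + real i * \<eta>" for i
  define X where "X i \<omega> = W (t (Suc i)) \<omega> - W (t i) \<omega>" for i \<omega>
  have ind: "indep_vars (\<lambda>_. borel) X {..<4}"
    unfolding X_def using assms by (intro independent_increments) (auto simp: t_def)
  have "small_increments b \<eta> a = (\<Inter>i\<in>{..<4}. X i -` {-b..b} \<inter> space M)"
  proof (intro set_eqI iffI)
    fix \<omega> assume "\<omega> \<in> (\<Inter>i\<in>{..<4}. X i -` {-b..b} \<inter> space M)"
    then have *: "\<omega> \<in> X i -` {-b..b} \<inter> space M" if "i < 4" for i using that by blast
    from *[of 0] have "\<omega> \<in> space M" by simp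
    moreover have "\<bar>X i \<omega>\<bar> \<le> b" if "i < 4" for i using *[OF that] by auto
    ultimately show "\<omega> \<in> small_increments b \<eta> a"
      unfolding small_increments_def X_def t_def by blast
  next
    fix \<omega> assume "\<omega> \<in> small_increments b \<eta> a"
    then have "\<omega> \<in> space M" "\<bar>X i \<omega>\<bar> \<le> b" if "i < 4" for i
      using that unfolding small_increments_def X_def t_def by blast+
    then show "\<omega> \<in> (\<Inter>i\<in>{..<4}. X i -` {-b..b} \<inter> space M)"
      by (auto simp: abs_le_iff minus_le_iff)
  qed
  also have "prob \<dots> = (\<Prod>i\<in>{..<4}. prob (X i -` {-b..b} \<inter> space M))"
  proof (rule indep_varsD_finite[OF ind])
    have "0 \<in> {..<4::nat}" by simp
    then show "{..<4::nat} \<noteq> {}" by blast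
  qed auto
  also have "\<dots> \<le> (\<Prod>i\<in>{..<4::nat}. 2 * b / sqrt (2 * pi * \<eta>))"
  proof (rule prod_mono)
    fix i
    show "0 \<le> prob (X i -` {-b..b} \<inter> space M) \<and>
      prob (X i -` {-b..b} \<inter> space M) \<le> 2 * b / sqrt (2 * pi * \<eta>)"
      using prob_increment_le[of "t i" "t (Suc i)" b] assms
      by (simp add: X_def[abs_def] t_def algebra_simps)
  qed
  also have "\<dots> = 16 * b ^ 4 / ((sqrt (2 * pi * \<eta>))\<^sup>2)\<^sup>2"
    by (simp add: power_divide power_mult_distrib flip: power_mult)
  also have "\<dots> = 4 * b ^ 4 / (pi\<^sup>2 * \<eta>\<^sup>2)"
    using assms by (simp add: power_mult_distrib)
  finally show ?thesis .
qed

lemma prob_UN_small_increments_le: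
  assumes "\<And>j. 0 \<le> a j" "0 < \<eta>" "0 \<le> b"
  shows "prob (\<Union>j<N::nat. small_increments b \<eta> (a j)) \<le> real N * (4 * b ^ 4 / (pi\<^sup>2 * \<eta>\<^sup>2))"
proof -
  have "prob (\<Union>j<N. small_increments b \<eta> (a j)) \<le> (\<Sum>j<N. prob (small_increments b \<eta> (a j)))"
    using assms sets_small_increments by (intro finite_measure_subadditive_finite) auto
  also have "\<dots> \<le> (\<Sum>j<N. 4 * b ^ 4 / (pi\<^sup>2 * \<eta>\<^sup>2))"
    using assms by (intro sum_mono prob_small_increments_le) auto
  finally show ?thesis by simp
qed

section \<open>Measurability and probability of a single slow level\<close>

lemma continuous_paths_unit: "\<omega> \<in> space M \<Longrightarrow> continuous_on {0..1} (\<lambda>t. W t \<omega>)"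
  using continuous_paths by (rule continuous_on_subset) auto

lemma sets_slow_level: "{\<omega> \<in> space M. n \<in> slow_levels R (\<lambda>t. W t \<omega>)} \<in> events"
proof -
  define cl where "cl = (\<lambda>x::real. max 0 (min 1 x))"
  \<comment> \<open>Clamped times are nonnegative, so the unconstrained values of \<open>W\<close>
    at negative times never enter.\<close>
  have [measurable]: "W (cl x) \<in> borel_measurable M" for x
    by (intro random_variable) (auto simp: cl_def)
  have "{\<omega> \<in> space M. n \<in> slow_levels R (\<lambda>t. W t \<omega>)} =
    {\<omega> \<in> space M. \<forall>m::nat. \<exists>x\<in>\<rat>. \<forall>y\<in>\<rat>.
      \<bar>W (cl x) \<omega> - W (cl (cl x + (1/2) ^ n * max (-1) (min 1 y))) \<omega>\<bar>
        \<le> R ^ n * (1/2) ^ n + 1 / real (Suc m)}"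
    unfolding cl_def by (intro Collect_cong conj_cong refl slow_level_iff_rational continuous_paths_unit)
  also have "\<dots> \<in> events"
    by (rule sets.sets_Collect_countable_All, rule sets.sets_Collect_countable_Ex'[OF _ countable_rat],
        rule sets.sets_Collect_countable_All'[OF _ countable_rat]) measurable
  finally show ?thesis .
qed

text \<open>Each point of the unit interval lies in a closed dyadic interval of length \<open>\<delta> = (1/2) ^ n\<close>, which
  its window of radius \<open>\<delta>\<close> contains; on it a slow path has four quarter increments of size at most
  \<open>2 * \<delta> * R ^ n\<close>. Having only \<open>2 ^ n\<close> such intervals is what gives the constant \<open>c_pi\<close>.\<close>

lemma slow_level_subset:
  "{\<omega> \<in> space M. n \<in> slow_levels R (\<lambda>t. W t \<omega>)}
    \<subseteq> (\<Union>j<2 ^ n::nat. small_increments (2 * ((1/2) ^ n * R ^ n)) ((1/2) ^ n / 4) (real j * (1/2) ^ n))"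
proof
  fix \<omega> assume "\<omega> \<in> {\<omega> \<in> space M. n \<in> slow_levels R (\<lambda>t. W t \<omega>)}"
  then obtain s where \<omega>: "\<omega> \<in> space M" and s: "s \<in> {0..1}" "window_osc (\<lambda>t. W t \<omega>) n s \<le> R ^ n"
    by (auto simp: slow_levels_def)
  define \<delta> :: real where "\<delta> = (1/2) ^ n"
  have \<delta>: "\<delta> > 0" "2 ^ n * \<delta> = 1" by (simp_all add: \<delta>_def power_divide)
  have close: "\<bar>W s \<omega> - W t \<omega>\<bar> \<le> R ^ n * \<delta>" if "t \<in> {s - \<delta>..s + \<delta>} \<inter> {0..1}" for t
    using s(2) that unfolding window_osc_le_iff[OF continuous_paths_unit[OF \<omega>] s(1)] \<delta>_def by blast
  \<comment> \<open>The point \<open>s = 1\<close> is treated apart: the floor would give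
    \<open>j = 2 ^ n\<close>, one past the last interval.\<close>
  obtain j :: nat where j: "j < 2 ^ n" "real j * \<delta> \<le> s" "s \<le> real (Suc j) * \<delta>"
  proof (cases "s = 1")
    case True
    have "real (2 ^ n - 1) = 2 ^ n - 1" by (simp add: of_nat_diff)
    then show ?thesis
      using \<delta> True by (intro that[of "2 ^ n - 1"]) (auto simp: algebra_simps)
  next
    case False
    define j where "j = nat \<lfloor>s * 2 ^ n\<rfloor>"
    have "real j = of_int \<lfloor>s * 2 ^ n\<rfloor>" using s(1) by (simp add: j_def)
    then have a: "real j \<le> s * 2 ^ n" "s * 2 ^ n \<le> real (Suc j)"
      by (simp_all, linarith+)
    have "real j * \<delta> \<le> s * 2 ^ n * \<delta>" "s * 2 ^ n * \<delta> \<le> real (Suc j) * \<delta>"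
      using a \<delta>(1) by (simp_all add: mult_right_mono del: of_nat_Suc)
    then have "real j * \<delta> \<le> s" "s \<le> real (Suc j) * \<delta>"
      using \<delta>(2) by (simp_all add: mult.assoc)
    moreover have "s * 2 ^ n < 1 * 2 ^ n"
      using s(1) False by (intro mult_strict_right_mono) auto
    then have "real j < 2 ^ n" using a(1) by linarith
    then have "j < 2 ^ n" by simp
    ultimately show ?thesis by (intro that)
  qed
  have "real (Suc j) \<le> real (2 ^ n)" using j(1) unfolding of_nat_le_iff by simp
  then have "real (Suc j) * \<delta> \<le> real (2 ^ n) * \<delta>"
    using \<delta>(1) by (intro mult_right_mono) auto
  then have top: "real j * \<delta> + \<delta> \<le> 1" using \<delta>(2) by (simp add: algebra_simps)
  have pt: "\<bar>W s \<omega> - W (real j * \<delta> + real i * (\<delta> / 4)) \<omega>\<bar> \<le> R ^ n * \<delta>" if "i \<le> 4" for i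
  proof (rule close)
    have "real i * (\<delta> / 4) \<le> 4 * (\<delta> / 4)"
      using that \<delta>(1) by (intro mult_right_mono) auto
    then have "0 \<le> real i * (\<delta> / 4)" "real i * (\<delta> / 4) \<le> \<delta>" "0 \<le> real j * \<delta>"
      using \<delta>(1) by auto
    then show "real j * \<delta> + real i * (\<delta> / 4) \<in> {s - \<delta>..s + \<delta>} \<inter> {0..1}"
      using j top \<delta>(1) unfolding Int_iff atLeastAtMost_iff of_nat_Suc distrib_right by linarith
  qed
  have "\<omega> \<in> small_increments (2 * (\<delta> * R ^ n)) (\<delta> / 4) (real j * \<delta>)"
    unfolding small_increments_def
  proof (intro CollectI conjI \<omega> allI impI)
    fix i :: nat assume "i < 4"
    then show "\<bar>W (real j * \<delta> + real (Suc i) * (\<delta> / 4)) \<omega> - W (real j * \<delta> + real i * (\<delta> / 4)) \<omega>\<bar>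
        \<le> 2 * (\<delta> * R ^ n)"
      using pt[of i] pt[of "Suc i"] by (simp only: mult.commute[of \<delta> "R ^ n"]) linarith
  qed
  with j(1) show "\<omega> \<in> (\<Union>j<2 ^ n::nat. small_increments (2 * ((1/2) ^ n * R ^ n)) ((1/2) ^ n / 4) (real j * (1/2) ^ n))"
    unfolding \<delta>_def by blast
qed

lemma prob_slow_level_le:
  assumes "0 < R"
  shows "prob {\<omega> \<in> space M. n \<in> slow_levels R (\<lambda>t. W t \<omega>)} \<le> c_pi * (R ^ 4 / 2) ^ n"
proof -
  define \<delta> :: real where "\<delta> = (1/2) ^ n"
  have \<delta>: "\<delta> > 0" "2 ^ n * \<delta> = 1" by (simp_all add: \<delta>_def power_divide)
  have "prob {\<omega> \<in> space M. n \<in> slow_levels R (\<lambda>t. W t \<omega>)}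
    \<le> prob (\<Union>j<2 ^ n::nat. small_increments (2 * (\<delta> * R ^ n)) (\<delta> / 4) (real j * \<delta>))"
    using \<delta>(1) unfolding \<delta>_def
    by (intro finite_measure_mono slow_level_subset sets.finite_UN sets_small_increments) auto
  also have "\<dots> \<le> real (2 ^ n) * (4 * (2 * (\<delta> * R ^ n)) ^ 4 / (pi\<^sup>2 * (\<delta> / 4)\<^sup>2))"
    using \<delta>(1) assms by (intro prob_UN_small_increments_le) auto
  \<comment> \<open>Origin of the constant: the factor 4 of the small-ball bound,
    \<open>2 ^ 4\<close> from the increment bound and \<open>4 ^ 2\<close> from the quarter steps
    give \<open>2 ^ 10\<close>. One of the two remaining powers of \<open>\<delta>\<close> cancels
    the number of intervals.\<close>
  also have "\<dots> = c_pi * ((2 ^ n * \<delta>) * (\<delta> * (R ^ n) ^ 4))"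
    using \<delta>(1) by (simp add: c_pi_def field_simps eval_nat_numeral)
  also have "\<delta> * (R ^ n) ^ 4 = (R ^ 4 / 2) ^ n"
    by (simp add: \<delta>_def power_divide mult.commute flip: power_mult)
  finally show ?thesis by (simp add: \<delta>(2))
qed

section \<open>Tail bounds for the last slow level and the number of slow levels\<close>

lemma sets_ex_slow_level: "{\<omega> \<in> space M. \<exists>n\<ge>k. n \<in> slow_levels R (\<lambda>t. W t \<omega>)} \<in> events"
  using sets_slow_level[measurable] by measurable

lemma prob_ex_slow_level_le:
  assumes "0 < R" "R ^ 4 < 2"
  shows "prob {\<omega> \<in> space M. \<exists>n\<ge>k. n \<in> slow_levels R (\<lambda>t. W t \<omega>)}
    \<le> c_pi * (R ^ 4 / 2) ^ k / (1 - R ^ 4 / 2)"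
proof -
  define q where "q = R ^ 4 / 2"
  have q: "0 < q" "q < 1" using assms by (auto simp: q_def)
  define A where "A n = {\<omega> \<in> space M. n + k \<in> slow_levels R (\<lambda>t. W t \<omega>)}" for n
  have A: "range A \<subseteq> events" using sets_slow_level by (auto simp: A_def)
  have le: "prob (A n) \<le> c_pi * q ^ k * q ^ n" for n
    using prob_slow_level_le[OF assms(1), of "n + k"]
    by (simp add: A_def q_def power_add algebra_simps)
  have sums: "(\<lambda>n. c_pi * q ^ k * q ^ n) sums (c_pi * q ^ k * (1 / (1 - q)))"
    using q by (intro sums_mult geometric_sums) auto
  have summable: "summable (\<lambda>n. prob (A n))"
    by (rule summable_comparison_test'[OF sums_summable[OF sums], of 0]) (use le in auto)
  have "{\<omega> \<in> space M. \<exists>n\<ge>k. n \<in> slow_levels R (\<lambda>t. W t \<omega>)} = (\<Union>n. A n)"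
  proof (intro equalityI subsetI)
    fix \<omega> assume "\<omega> \<in> {\<omega> \<in> space M. \<exists>n\<ge>k. n \<in> slow_levels R (\<lambda>t. W t \<omega>)}"
    then obtain n where "\<omega> \<in> space M" "k \<le> n" "n \<in> slow_levels R (\<lambda>t. W t \<omega>)" by blast
    then have "\<omega> \<in> A (n - k)" by (simp add: A_def)
    then show "\<omega> \<in> (\<Union>n. A n)" by blast
  next
    fix \<omega> assume "\<omega> \<in> (\<Union>n. A n)"
    then show "\<omega> \<in> {\<omega> \<in> space M. \<exists>n\<ge>k. n \<in> slow_levels R (\<lambda>t. W t \<omega>)}"
      unfolding A_def using le_add2[of k] by blast
  qed
  also have "prob \<dots> \<le> (\<Sum>n. prob (A n))"
    by (rule finite_measure_subadditive_countably[OF A summable])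
  also have "\<dots> \<le> (\<Sum>n. c_pi * q ^ k * q ^ n)"
    by (intro suminf_le le summable sums_summable[OF sums])
  also have "\<dots> = c_pi * q ^ k * (1 / (1 - q))" using sums by (simp add: sums_iff)
  finally show ?thesis by (simp add: q_def)
qed

lemma sets_last_slow_level:
  assumes "1 \<le> k"
  shows "{\<omega> \<in> space M. enat k \<le> last_slow_level R (\<lambda>u. W u \<omega>)} \<in> events"
  unfolding enat_le_last_slow_level_iff[OF assms] by (rule sets_ex_slow_level)

lemma sets_number_slow_levels:
  "{\<omega> \<in> space M. enat k \<le> number_slow_levels R (\<lambda>u. W u \<omega>)} \<in> events"
proof -
  \<comment> \<open>There are only countably many finite sets of levels, so the cardinality
    condition becomes a countable union.\<close>
  have "{\<omega> \<in> space M. enat k \<le> number_slow_levels R (\<lambda>u. W u \<omega>)} =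
    (\<Union>F\<in>{F. finite F \<and> card F = k}. {\<omega> \<in> space M. \<forall>n\<in>F. n \<in> slow_levels R (\<lambda>u. W u \<omega>)})"
    by (auto simp: enat_le_number_slow_levels_iff)
  also have "\<dots> \<in> events"
  proof (rule sets.countable_UN'')
    show "countable {F :: nat set. finite F \<and> card F = k}"
      by (rule countable_subset[OF _ countable_Collect_finite]) auto
    show "{\<omega> \<in> space M. \<forall>n\<in>F. n \<in> slow_levels R (\<lambda>u. W u \<omega>)} \<in> events"
      if "F \<in> {F. finite F \<and> card F = k}" for F
      using that sets_slow_level by (intro sets.sets_Collect_finite_All) auto
  qed
  finally show ?thesis .
qed

lemma prob_last_slow_level_le:
  assumes "0 < R" "R ^ 4 < 2" "1 \<le> k"
  shows "prob {\<omega> \<in> space M. enat k \<le> last_slow_level R (\<lambda>u. W u \<omega>)} \<le> tail_bound R k"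
proof (rule geometric_tail_le_tail_bound[OF assms])
  \<comment> \<open>Weakening \<open>k\<close> to \<open>k - 1\<close> brings the event under the
    numerical estimate shared with the count.\<close>
  have "prob {\<omega> \<in> space M. enat k \<le> last_slow_level R (\<lambda>u. W u \<omega>)}
    \<le> prob {\<omega> \<in> space M. \<exists>n\<ge>k - 1. n \<in> slow_levels R (\<lambda>t. W t \<omega>)}"
    unfolding enat_le_last_slow_level_iff[OF assms(3)]
    by (intro finite_measure_mono sets_ex_slow_level) (blast intro: order_trans[OF diff_le_self])
  also have "\<dots> \<le> c_pi * (R ^ 4 / 2) ^ (k - 1) / (1 - R ^ 4 / 2)"
    by (rule prob_ex_slow_level_le[OF assms(1,2)])
  finally show "prob {\<omega> \<in> space M. enat k \<le> last_slow_level R (\<lambda>u. W u \<omega>)}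
    \<le> c_pi * (R ^ 4 / 2) ^ (k - 1) / (1 - R ^ 4 / 2)" .
qed simp

lemma prob_number_slow_levels_le:
  assumes "0 < R" "R ^ 4 < 2" "1 \<le> k"
  shows "prob {\<omega> \<in> space M. enat k \<le> number_slow_levels R (\<lambda>u. W u \<omega>)} \<le> tail_bound R k"
proof (rule geometric_tail_le_tail_bound[OF assms])
  have "prob {\<omega> \<in> space M. enat k \<le> number_slow_levels R (\<lambda>u. W u \<omega>)}
    \<le> prob {\<omega> \<in> space M. \<exists>n\<ge>k - 1. n \<in> slow_levels R (\<lambda>t. W t \<omega>)}"
    using ex_slow_level_of_number[of "k - 1"] assms(3)
    by (intro finite_measure_mono sets_ex_slow_level) auto
  also have "\<dots> \<le> c_pi * (R ^ 4 / 2) ^ (k - 1) / (1 - R ^ 4 / 2)"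
    by (rule prob_ex_slow_level_le[OF assms(1,2)])
  finally show "prob {\<omega> \<in> space M. enat k \<le> number_slow_levels R (\<lambda>u. W u \<omega>)}
    \<le> c_pi * (R ^ 4 / 2) ^ (k - 1) / (1 - R ^ 4 / 2)" .
qed simp

text \<open>The shift to \<open>k + 1\<close> accounts for level 0: if exactly the \<open>k\<close>
  levels below \<open>k\<close> are slow, their supremum is only \<open>k - 1\<close>.\<close>

lemma prob_number_le_prob_last:
  assumes "1 \<le> k"
  shows "prob {\<omega> \<in> space M. enat (k + 1) \<le> number_slow_levels R (\<lambda>u. W u \<omega>)}
    \<le> prob {\<omega> \<in> space M. enat k \<le> last_slow_level R (\<lambda>u. W u \<omega>)}"
  unfolding enat_le_last_slow_level_iff[OF assms]
  using ex_slow_level_of_number[of k] by (intro finite_measure_mono sets_ex_slow_level) auto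

section \<open>Null set of paths with a point of bounded right difference quotients\<close>

text \<open>The increments start at \<open>real (Suc j) / real n\<close>, to the right of the point
  \<open>t\<close> with \<open>j = nat \<lfloor>t * real n\<rfloor>\<close>, because only right
  difference quotients are controlled; times beyond 1 occur. All five grid points are within
  \<open>5 / real n\<close> of \<open>t\<close>, and comparing two of them through \<open>t\<close>
  doubles 5 to 10.\<close>

definition flat_at_scale :: "nat \<Rightarrow> nat \<Rightarrow> 'w set" where
  "flat_at_scale K n =
    (\<Union>j<Suc n. small_increments (10 * real K / real n) (1 / real n) (real (Suc j) / real n))"

lemma sets_flat_at_scale: "0 < n \<Longrightarrow> flat_at_scale K n \<in> events"
  unfolding flat_at_scale_def by (intro sets.finite_UN sets_small_increments) auto

lemma prob_flat_at_scale_tendsto_0: "(\<lambda>n. prob (flat_at_scale K (Suc n))) \<longlonglongrightarrow> 0"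
proof (rule tendsto_sandwich[where f = "\<lambda>_. 0"])
  define C where "C = 4 * (10 * real K) ^ 4 / pi\<^sup>2"
  show "\<forall>\<^sub>F n in sequentially. prob (flat_at_scale K (Suc n)) \<le> 2 * C * (1 / real (Suc n))"
  proof (rule always_eventually, rule allI)
    fix n
    let ?m = "real (Suc n)"
    have "prob (flat_at_scale K (Suc n)) \<le>
      real (Suc (Suc n)) * (4 * (10 * real K / ?m) ^ 4 / (pi\<^sup>2 * (1 / ?m)\<^sup>2))"
      unfolding flat_at_scale_def by (rule prob_UN_small_increments_le) auto
    also have "4 * (10 * real K / ?m) ^ 4 / (pi\<^sup>2 * (1 / ?m)\<^sup>2) = C / ?m\<^sup>2"
      unfolding C_def by (simp add: divide_simps del: of_nat_Suc)
    also have "real (Suc (Suc n)) * (C / ?m\<^sup>2) \<le> (2 * ?m) * (C / ?m\<^sup>2)"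
      by (intro mult_right_mono) (auto simp: C_def)
    also have "\<dots> = 2 * C * (1 / ?m)" by (simp add: power2_eq_square del: of_nat_Suc)
    finally show "prob (flat_at_scale K (Suc n)) \<le> 2 * C * (1 / ?m)" .
  qed
  have "(\<lambda>n. 2 * C * (1 / real (Suc n))) \<longlonglongrightarrow> 2 * C * 0"
    by (intro tendsto_intros LIMSEQ_Suc[OF lim_1_over_n])
  then show "(\<lambda>n. 2 * C * (1 / real (Suc n))) \<longlonglongrightarrow> 0" by simp
qed auto

text \<open>The intersection lies in each of its members, and their probabilities tend to 0.
  \<open>Suc\<close> keeps the scale positive.\<close>

lemma null_flat_eventually: "(\<Inter>n. flat_at_scale K (Suc (n0 + n))) \<in> null_sets M"
proof -
  let ?A = "\<Inter>n. flat_at_scale K (Suc (n0 + n))"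
  have A: "?A \<in> events" using sets_flat_at_scale by (intro sets.countable_INT) auto
  have "prob ?A \<le> 0"
  proof (rule LIMSEQ_le_const)
    show "(\<lambda>n. prob (flat_at_scale K (Suc (n0 + n)))) \<longlonglongrightarrow> 0"
      using LIMSEQ_ignore_initial_segment[OF prob_flat_at_scale_tendsto_0, of K n0]
      by (simp add: add.commute)
    show "\<exists>N. \<forall>n\<ge>N. prob ?A \<le> prob (flat_at_scale K (Suc (n0 + n)))"
      using sets_flat_at_scale by (auto intro!: finite_measure_mono)
  qed
  then have "prob ?A = 0" using measure_nonneg by (rule antisym)
  with A show ?thesis by (simp add: null_sets_def emeasure_eq_measure)
qed

lemma flat_at_scale_if_bounded_quotient:
  assumes \<omega>: "\<omega> \<in> space M" and t: "t \<in> {0..1}" and n: "0 < n" "5 / real n < d"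
    and bound: "\<And>h. 0 < h \<Longrightarrow> h < d \<Longrightarrow> \<bar>(W (t + h) \<omega> - W t \<omega>) / h\<bar> \<le> real K"
  shows "\<omega> \<in> flat_at_scale K n"
proof -
  define j where "j = nat \<lfloor>t * real n\<rfloor>"
  have "real j = of_int \<lfloor>t * real n\<rfloor>" using t by (simp add: j_def)
  then have j: "real j \<le> t * real n" "t * real n < real j + 1" by linarith+
  have "t * real n \<le> 1 * real n" using t by (intro mult_right_mono) auto
  with j(1) have jn: "j < Suc n" by linarith
  have pt: "\<bar>W (real (Suc j) / real n + real i * (1 / real n)) \<omega> - W t \<omega>\<bar> \<le> 5 * real K / real n"
    if "i \<le> 4" for i
  proof -
    define h where "h = real (Suc j) / real n + real i * (1 / real n) - t"
    \<comment> \<open>In units of \<open>1 / real n\<close> the distance from \<open>t\<close> lies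
      in \<open>(0, 5]\<close>: the fractional part of \<open>t * real n\<close> is below 1, and
      \<open>i \<le> 4\<close>.\<close>
    have hn: "h * real n = real j + 1 + real i - t * real n"
      using n(1) by (simp add: h_def field_simps)
    have "0 < h * real n" "h * real n \<le> 5" using j that by (auto simp: hn)
    then have h: "0 < h" "h \<le> 5 / real n" using n(1) by (auto simp: zero_less_mult_iff field_simps)
    have "\<bar>W (t + h) \<omega> - W t \<omega>\<bar> \<le> real K * h"
      using bound[of h] h n(2) by (simp add: abs_divide pos_divide_le_eq)
    also have "\<dots> \<le> real K * (5 / real n)" using h by (intro mult_left_mono) auto
    finally show ?thesis by (simp add: h_def mult.commute)
  qed
  have "\<omega> \<in> small_increments (10 * real K / real n) (1 / real n) (real (Suc j) / real n)"
    unfolding small_increments_def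
  proof (intro CollectI conjI \<omega> allI impI)
    fix i :: nat assume "i < 4"
    moreover have "10 * real K / real n = 5 * real K / real n + 5 * real K / real n" by simp
    ultimately show "\<bar>W (real (Suc j) / real n + real (Suc i) * (1 / real n)) \<omega>
      - W (real (Suc j) / real n + real i * (1 / real n)) \<omega>\<bar> \<le> 10 * real K / real n"
      using pt[of i] pt[of "Suc i"] by linarith
  qed
  with jn show ?thesis unfolding flat_at_scale_def by blast
qed

end

text \<open>A limsup other than \<open>\<infinity>\<close> bounds the quotient above for small
  \<open>h\<close>, and a liminf other than \<open>-\<infinity>\<close> bounds it below. Taking
  \<open>K\<close> natural allows a countable union later.\<close>

lemma bounded_quotient_if_dini_finite:
  assumes "upper_right_dini f t \<noteq> \<infinity>" "lower_right_dini f t \<noteq> -\<infinity>"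
  obtains d :: real and K :: nat
  where "d > 0" "\<forall>h. 0 < h \<longrightarrow> h < d \<longrightarrow> \<bar>(f (t + h) - f t) / h\<bar> \<le> real K"
proof -
  obtain a where a: "upper_right_dini f t < ereal a"
    using assms(1) less_PInf_Ex_of_nat by (metis ereal_less_PInfty less_PInf_Ex_of_nat)
  obtain b where b: "ereal b < lower_right_dini f t"
    using assms(2) by (metis MInfty_neq_ereal(1) ereal_dense2 ereal_less_eq(2) less_le)
  have "\<forall>\<^sub>F h in at_right 0. (f (t + h) - f t) / h < a"
    using Limsup_lessD[OF a[unfolded upper_right_dini_def]] by simp
  moreover have "\<forall>\<^sub>F h in at_right 0. b < (f (t + h) - f t) / h"
    using less_LiminfD[OF b[unfolded lower_right_dini_def]] by simp
  ultimately have "\<forall>\<^sub>F h in at_right 0. b < (f (t + h) - f t) / h \<and> (f (t + h) - f t) / h < a"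
    by (rule eventually_conj[rotated])
  then obtain d where d: "d > 0"
    "\<And>h. 0 < h \<Longrightarrow> h < d \<Longrightarrow> b < (f (t + h) - f t) / h \<and> (f (t + h) - f t) / h < a"
    unfolding eventually_at_right_field by auto
  obtain K :: nat where K: "max \<bar>a\<bar> \<bar>b\<bar> \<le> real K" using real_arch_simple by blast
  show ?thesis
  proof (intro that[OF d(1)] allI impI)
    fix h :: real assume "0 < h" "h < d"
    then show "\<bar>(f (t + h) - f t) / h\<bar> \<le> real K" using d(2)[of h] K by linarith
  qed
qed

section \<open>Assembly of the almost sure event and the tail bounds\<close>

theorem theorem6:
  fixes M :: "'w measure" and W :: "real \<Rightarrow> 'w \<Rightarrow> real"
  assumes "brownian_motion M W"
  shows "\<exists>E \<in> sets M. measure M E = 1 \<and>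
    E \<subseteq> {\<omega> \<in> space M. \<forall>t\<in>{0..1}.
            upper_right_dini (\<lambda>u. W u \<omega>) t = \<infinity> \<or> lower_right_dini (\<lambda>u. W u \<omega>) t = -\<infinity>} \<and>
    (\<forall>R::real. 1 < R \<and> R < 2 powr (1/4) \<longrightarrow>
      (\<forall>\<omega>\<in>E. \<forall>n::nat. last_slow_level R (\<lambda>u. W u \<omega>) < enat n \<longrightarrow>
          (\<forall>s\<in>{0..1}. R ^ n < window_osc (\<lambda>u. W u \<omega>) n s)) \<and>
      (\<forall>k::nat. 1 \<le> k \<longrightarrow>
          {\<omega> \<in> space M. enat k \<le> number_slow_levels R (\<lambda>u. W u \<omega>)} \<in> sets M \<and>
          {\<omega> \<in> space M. enat k \<le> last_slow_level R (\<lambda>u. W u \<omega>)} \<in> sets M \<and>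
          measure M {\<omega> \<in> space M. enat (k + 1) \<le> number_slow_levels R (\<lambda>u. W u \<omega>)}
            \<le> measure M {\<omega> \<in> space M. enat k \<le> last_slow_level R (\<lambda>u. W u \<omega>)} \<and>
          measure M {\<omega> \<in> space M. enat k \<le> number_slow_levels R (\<lambda>u. W u \<omega>)} \<le> tail_bound R k \<and>
          measure M {\<omega> \<in> space M. enat k \<le> last_slow_level R (\<lambda>u. W u \<omega>)} \<le> tail_bound R k))"
proof -
  interpret brownian_motion M W by (rule assms)
  \<comment> \<open>The complement of this null set is the event \<open>E\<close>. It is chosen
    before \<open>R\<close>, so one event serves every \<open>R\<close>.\<close>
  define Z where "Z = (\<Union>K. \<Union>n0. \<Inter>n. flat_at_scale K (Suc (n0 + n)))"
  have Z: "Z \<in> null_sets M"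
    unfolding Z_def using null_flat_eventually by (intro null_sets_UN)
  have dini: "upper_right_dini (\<lambda>u. W u \<omega>) t = \<infinity> \<or> lower_right_dini (\<lambda>u. W u \<omega>) t = -\<infinity>"
    if \<omega>: "\<omega> \<in> space M" "\<omega> \<notin> Z" and t: "t \<in> {0..1}" for \<omega> t
  proof (rule ccontr)
    assume "\<not> ?thesis"
    then have "upper_right_dini (\<lambda>u. W u \<omega>) t \<noteq> \<infinity>" "lower_right_dini (\<lambda>u. W u \<omega>) t \<noteq> -\<infinity>"
      by auto
    then obtain d :: real and K :: nat where d: "d > 0"
      "\<forall>h. 0 < h \<longrightarrow> h < d \<longrightarrow> \<bar>(W (t + h) \<omega> - W t \<omega>) / h\<bar> \<le> real K"
      by (rule bounded_quotient_if_dini_finite)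
    obtain n0 :: nat where "5 / d < real n0" using reals_Archimedean2 by blast
    then have "5 < d * real n0" using d(1) by (simp add: field_simps)
    have "5 / real (Suc (n0 + n)) < d" for n
    proof -
      have "d * real n0 \<le> d * real (Suc (n0 + n))" using d(1) by (intro mult_left_mono) auto
      with \<open>5 < d * real n0\<close> show ?thesis by (simp add: pos_divide_less_eq)
    qed
    then have "\<omega> \<in> flat_at_scale K (Suc (n0 + n))" for n
      by (rule flat_at_scale_if_bounded_quotient[OF \<omega>(1) t zero_less_Suc]) (use d(2) in blast)
    with \<omega>(2) show False by (auto simp: Z_def)
  qed
  show ?thesis
  proof (intro bexI[of _ "space M - Z"] conjI allI impI ballI)
    show "space M - Z \<in> events" using Z by auto
    show "prob (space M - Z) = 1"
      using Z by (simp add: prob_compl null_sets_def emeasure_eq_measure)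
    show "space M - Z \<subseteq> {\<omega> \<in> space M. \<forall>t\<in>{0..1}.
      upper_right_dini (\<lambda>u. W u \<omega>) t = \<infinity> \<or> lower_right_dini (\<lambda>u. W u \<omega>) t = -\<infinity>}"
      using dini by blast
  next
    fix R :: real and \<omega> n and s :: real
    assume "last_slow_level R (\<lambda>u. W u \<omega>) < enat n" "s \<in> {0..1}"
    \<comment> \<open>This holds path by path. If infinitely many levels are slow, the supremum is
      \<open>\<infinity>\<close> and no such \<open>n\<close> exists.\<close>
    then have "n \<notin> slow_levels R (\<lambda>u. W u \<omega>)"
      unfolding last_slow_level_def by (meson SUP_upper leD)
    then show "R ^ n < window_osc (\<lambda>u. W u \<omega>) n s"
      using \<open>s \<in> {0..1}\<close> by (auto simp: slow_levels_def not_le)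
  next
    fix R :: real and k :: nat
    assume R: "1 < R \<and> R < 2 powr (1/4)" and k: "1 \<le> k"
    have "R ^ 4 < (2 powr (1/4)) ^ 4" using R by (intro power_strict_mono) auto
    also have "\<dots> = (2::real)" by (simp add: powr_power)
    finally have R': "0 < R" "R ^ 4 < 2" using R by auto
    show "{\<omega> \<in> space M. enat k \<le> number_slow_levels R (\<lambda>u. W u \<omega>)} \<in> events"
      by (rule sets_number_slow_levels)
    show "{\<omega> \<in> space M. enat k \<le> last_slow_level R (\<lambda>u. W u \<omega>)} \<in> events"
      using k by (rule sets_last_slow_level)
    show "prob {\<omega> \<in> space M. enat (k + 1) \<le> number_slow_levels R (\<lambda>u. W u \<omega>)}
      \<le> prob {\<omega> \<in> space M. enat k \<le> last_slow_level R (\<lambda>u. W u \<omega>)}"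
      using k by (rule prob_number_le_prob_last)
    show "prob {\<omega> \<in> space M. enat k \<le> number_slow_levels R (\<lambda>u. W u \<omega>)} \<le> tail_bound R k"
      using R' k by (rule prob_number_slow_levels_le)
    show "prob {\<omega> \<in> space M. enat k \<le> last_slow_level R (\<lambda>u. W u \<omega>)} \<le> tail_bound R k"
      using R' k by (rule prob_last_slow_level_le)
  qed
qed

end
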